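(* Let $c=(c_1,\dots,c_n)\in\mathbb C^n$ and let $X=\operatorname{Spec}(A_0\oplus\xi J)$ be an affine toric supervariety with supertorus $T_{\mathbb Z^n,c}$, where $A_0=\mathbb C[S]$ for an affine semigroup $S$ with $\mathbb ZS=\mathbb Z^n$ and $J\subseteq A_0$ is a nonzero $T_{\mathbb Z^n}$-invariant ideal containing $J_c=(x^m\in\mathbb C[S]\mid\langle m,c\rangle\neq0)$. Let $$Q=\xi\Big(c_1x_1\frac{\partial}{\partial x_1}+\dots+c_nx_n\frac{\partial}{\partial x_n}\Big)+\frac{\partial}{\partial\xi}$$ acting on $\mathbb C[X]=A_0\oplus\xi J$. Then $DS_Q\,\mathbb C[X]\cong A_0/J$.
   Context: Ground field $\mathbb C$. $\mathbb C[X]=\mathbb C[S]\oplus\xi J$ is regarded as a subsuperalgebra of $\mathbb C[x_1^{\pm1},\dots,x_n^{\pm1},\xi]$ with $\xi$ odd, $\xi^2=0$; $x^m=x_1^{m_1}\cdots x_n^{m_n}$, and $\langle m,c\rangle=\sum m_ic_i$. $T_{\mathbb Z^n}=(\mathbb C^\times)^n$ acts on $x^m$ by the character $m$. The supertorus $T_{\mathbb Z^n,c}$ is the supergroup with coordinate Hopf superalgebra $\mathbb C[x_1^{\pm1},\dots,x_n^{\pm1},\xi]$, $\Delta x^m=x^m\otimes x^m(1+\langle m,c\rangle\xi\otimes\xi)$, $\Delta\xi=\xi\otimes1+1\otimes\xi$; a toric supervariety with this supertorus is a supervariety containing it as an open subscheme so that its action on itself extends to the whole supervariety. The odd derivation $Q$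 comes from the action of the odd part of the Lie superalgebra of $T_{\mathbb Z^n,c}$; it satisfies $Q(x^m)=\langle m,c\rangle x^m\xi$ and $Q(x^m\xi)=x^m$. The Duflo-Serganova functor is $$DS_Q\,\mathbb C[X]=\frac{\ker\big(Q|_{\mathbb C[X]^{Q^2}}\big)}{Q\big(\mathbb C[X]^{Q^2}\big)},\qquad \mathbb C[X]^{Q^2}=\{f\in\mathbb C[X]\mid Q^2f=0\}.$$ The isomorphism is of superalgebras ($A_0/J$ being purely even). *)

theory Defs
  imports
    "HOL-Analysis.Finite_Cartesian_Product"
    "HOL-Algebra.QuotRing"
    "HOL-Algebra.Subrings"
    "HOL-Library.Poly_Mapping"
    "HOL-Library.Product_Plus"
begin

section \<open>Complex superalgebras\<close>

record 'a superalgebra = "(complex, 'a) module" +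
  even_part :: "'a set"
  odd_part :: "'a set"

definition restrict_superalgebra :: "'a superalgebra \<Rightarrow> 'a set \<Rightarrow> 'a superalgebra" where
  "restrict_superalgebra R B =
     R \<lparr>carrier := B, even_part := even_part R \<inter> B, odd_part := odd_part R \<inter> B\<rparr>"

definition subsuperalgebra :: "'a set \<Rightarrow> 'a superalgebra \<Rightarrow> bool" where
  "subsuperalgebra B R \<longleftrightarrow>
     subring B R \<and>
     (\<forall>a. \<forall>x\<in>B. a \<odot>\<^bsub>R\<^esub> x \<in> B) \<and>
     (\<forall>x\<in>B. \<exists>u\<in>even_part R \<inter> B. \<exists>v\<in>odd_part R \<inter> B. x = u \<oplus>\<^bsub>R\<^esub> v)"

definition generated_subsuperalgebra :: "'a superalgebra \<Rightarrow> 'a set \<Rightarrow> 'a set" where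
  "generated_subsuperalgebra R F = \<Inter>{B. subsuperalgebra B R \<and> F \<subseteq> B}"

definition quotient_superalgebra :: "'a superalgebra \<Rightarrow> 'a set \<Rightarrow> 'a set superalgebra" where
  "quotient_superalgebra R I =
     \<lparr>carrier = carrier (R Quot I), mult = mult (R Quot I), one = one (R Quot I),
      zero = zero (R Quot I), add = add (R Quot I),
      smult = (\<lambda>a C. \<Union>x\<in>C. I +>\<^bsub>R\<^esub> (a \<odot>\<^bsub>R\<^esub> x)),
      even_part = (\<lambda>x. I +>\<^bsub>R\<^esub> x) ` even_part R,
      odd_part = (\<lambda>x. I +>\<^bsub>R\<^esub> x) ` odd_part R\<rparr>"

definition superalgebra_iso :: "'a superalgebra \<Rightarrow> 'b superalgebra \<Rightarrow> ('a \<Rightarrow> 'b) set" where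
  "superalgebra_iso R S =
     {h \<in> ring_iso R S.
        (\<forall>a. \<forall>x\<in>carrier R. h (a \<odot>\<^bsub>R\<^esub> x) = a \<odot>\<^bsub>S\<^esub> h x) \<and>
        h ` even_part R = even_part S \<and>
        h ` odd_part R = odd_part S}"

definition superalgebra_isomorphic :: "'a superalgebra \<Rightarrow> 'b superalgebra \<Rightarrow> bool"
    (infix \<open>\<cong>\<^sub>s\<close> 50) where
  "R \<cong>\<^sub>s S \<longleftrightarrow> superalgebra_iso R S \<noteq> {}"

section \<open>The Duflo-Serganova functor\<close>

definition square_invariants :: "'a superalgebra \<Rightarrow> ('a \<Rightarrow> 'a) \<Rightarrow> 'a set" where
  "square_invariants R Q = {f \<in> carrier R. Q (Q f) = \<zero>\<^bsub>R\<^esub>}"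

definition DS :: "('a \<Rightarrow> 'a) \<Rightarrow> 'a superalgebra \<Rightarrow> 'a set superalgebra" where
  "DS Q R =
     quotient_superalgebra
       (restrict_superalgebra R {f \<in> square_invariants R Q. Q f = \<zero>\<^bsub>R\<^esub>})
       (Q ` square_invariants R Q)"

section \<open>Laurent polynomials\<close>

text \<open>The multiplication of \<^typ>\<open>(int ^ 'n) \<Rightarrow>\<^sub>0 complex\<close> is the convolution product, so this type
  is the group algebra of the lattice of exponents.\<close>

type_synonym 'n laurent = "(int ^ 'n) \<Rightarrow>\<^sub>0 complex"

abbreviation laurent_monomial :: "int ^ 'n::finite \<Rightarrow> 'n laurent" where
  "laurent_monomial m \<equiv> Poly_Mapping.single m 1"

abbreviation laurent_var :: "'n::finite \<Rightarrow> 'n laurent" where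
  "laurent_var i \<equiv> laurent_monomial (axis i 1)"

definition laurent_scale :: "complex \<Rightarrow> 'n::finite laurent \<Rightarrow> 'n laurent" where
  "laurent_scale a f = Poly_Mapping.map ((*) a) f"

definition laurent_deriv :: "'n::finite \<Rightarrow> 'n laurent \<Rightarrow> 'n laurent" where
  "laurent_deriv i f =
     (\<Sum>m\<in>Poly_Mapping.keys f.
        Poly_Mapping.single (m - axis i 1) (of_int (m $ i) * Poly_Mapping.lookup f m))"

definition pairing :: "int ^ 'n::finite \<Rightarrow> complex ^ 'n \<Rightarrow> complex" where
  "pairing m c = (\<Sum>i\<in>UNIV. of_int (m $ i) * c $ i)"

section \<open>The supertorus\<close>

text \<open>The pair \<open>(f, g)\<close> stands for \<open>f + \<xi> g\<close>. Since \<open>\<xi>\<^sup>2 = 0\<close> and Laurent polynomials are even,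
  no signs occur in the product.\<close>

type_synonym 'n super_laurent = "'n laurent \<times> 'n laurent"

definition super_mult ::
    "'n::finite super_laurent \<Rightarrow> 'n super_laurent \<Rightarrow> 'n super_laurent" where
  "super_mult F G = (fst F * fst G, fst F * snd G + snd F * fst G)"

definition super_scale :: "complex \<Rightarrow> 'n::finite super_laurent \<Rightarrow> 'n super_laurent" where
  "super_scale a F = (laurent_scale a (fst F), laurent_scale a (snd F))"

definition torus_superalgebra :: "'n::finite super_laurent superalgebra" where
  "torus_superalgebra =
     \<lparr>carrier = UNIV, mult = super_mult, one = (1, 0), zero = (0, 0), add = (+),
      smult = super_scale, even_part = UNIV \<times> {0}, odd_part = {0} \<times> UNIV\<rparr>"

text \<open>The comultiplication, with \<open>\<Delta>(x\<^sup>m) = x\<^sup>m \<otimes> x\<^sup>m + \<langle>m, c\<rangle> x\<^sup>m \<xi> \<otimes> x\<^sup>m \<xi>\<close> and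
  \<open>\<Delta>(x\<^sup>m \<xi>) = \<Delta>(x\<^sup>m) \<Delta>(\<xi>) = x\<^sup>m \<xi> \<otimes> x\<^sup>m + x\<^sup>m \<otimes> x\<^sup>m \<xi>\<close>. A tensor is represented by its coefficients
  in the second factor with respect to the basis of the first factor, where \<open>(m, False)\<close> indexes
  \<open>x\<^sup>m\<close> and \<open>(m, True)\<close> indexes \<open>x\<^sup>m \<xi>\<close>.\<close>

definition comult ::
    "complex ^ 'n::finite \<Rightarrow> 'n super_laurent \<Rightarrow> ((int ^ 'n) \<times> bool) \<Rightarrow>\<^sub>0 'n super_laurent" where
  "comult c F =
     (\<Sum>m\<in>Poly_Mapping.keys (fst F). let a = Poly_Mapping.lookup (fst F) m in
        Poly_Mapping.single (m, False) (Poly_Mapping.single m a, 0) +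
        Poly_Mapping.single (m, True) (0, Poly_Mapping.single m (a * pairing m c))) +
     (\<Sum>m\<in>Poly_Mapping.keys (snd F). let b = Poly_Mapping.lookup (snd F) m in
        Poly_Mapping.single (m, True) (Poly_Mapping.single m b, 0) +
        Poly_Mapping.single (m, False) (0, Poly_Mapping.single m b))"

section \<open>Affine toric supervarieties\<close>

text \<open>The inclusion of \<open>B\<close> in the coordinate superalgebra \<open>T\<close> of the supertorus induces an open
  immersion of spectra iff the supertorus is covered by finitely many basic open sets \<open>D(f)\<close>
  with \<open>f\<close> an even element of \<open>B\<close> such that \<open>B\<^sub>f = T\<^sub>f\<close>; the localization map
  is always injective, so the last condition concerns surjectivity only.\<close>

definition contains_torus_openly :: "'n::finite super_laurent set \<Rightarrow> bool" where
  "contains_torus_openly B \<longleftrightarrow>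
     (\<exists>F. finite F \<and> F \<subseteq> even_part torus_superalgebra \<inter> B \<and>
        Idl\<^bsub>torus_superalgebra\<^esub> F = carrier torus_superalgebra \<and>
        (\<forall>f\<in>F. \<forall>g. \<exists>k::nat. (f [^]\<^bsub>torus_superalgebra\<^esub> k) \<otimes>\<^bsub>torus_superalgebra\<^esub> g \<in> B))"

text \<open>The action of the supertorus on itself extends to \<open>Spec B\<close> iff the comultiplication
  restricts to a coaction, that is, it maps \<open>B\<close> to \<open>T \<otimes> B\<close>.\<close>

definition torus_action_extends ::
    "complex ^ 'n::finite \<Rightarrow> 'n super_laurent set \<Rightarrow> bool" where
  "torus_action_extends c B \<longleftrightarrow> (\<forall>F\<in>B. \<forall>p. Poly_Mapping.lookup (comult c F) p \<in> B)"

definition affine_toric_supervariety ::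
    "complex ^ 'n::finite \<Rightarrow> 'n super_laurent set \<Rightarrow> bool" where
  "affine_toric_supervariety c B \<longleftrightarrow>
     subsuperalgebra B torus_superalgebra \<and>
     (\<exists>F. finite F \<and> B = generated_subsuperalgebra torus_superalgebra F) \<and>
     contains_torus_openly B \<and>
     torus_action_extends c B"

definition affine_semigroup :: "(int ^ 'n::finite) set \<Rightarrow> bool" where
  "affine_semigroup S \<longleftrightarrow>
     (\<exists>F. finite F \<and> S = {\<Sum>v\<in>F. int (a v) *s v | a :: int ^ 'n \<Rightarrow> nat. True})"

definition lattice_span :: "(int ^ 'n::finite) set \<Rightarrow> (int ^ 'n) set" where
  "lattice_span S = {\<Sum>v\<in>F. a v *s v | F a. finite F \<and> F \<subseteq> S}"

definition semigroup_algebra :: "(int ^ 'n::finite) set \<Rightarrow> 'n laurent superalgebra" where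
  "semigroup_algebra S =
     \<lparr>carrier = {f. Poly_Mapping.keys f \<subseteq> S}, mult = (*), one = 1, zero = 0, add = (+),
      smult = laurent_scale, even_part = {f. Poly_Mapping.keys f \<subseteq> S}, odd_part = {0}\<rparr>"

definition torus_act :: "complex ^ 'n::finite \<Rightarrow> 'n laurent \<Rightarrow> 'n laurent" where
  "torus_act t f = Poly_Mapping.mapp (\<lambda>m a. (\<Prod>i\<in>UNIV. t $ i powi m $ i) * a) f"

definition torus_invariant :: "'n::finite laurent set \<Rightarrow> bool" where
  "torus_invariant J \<longleftrightarrow> (\<forall>t. (\<forall>i. t $ i \<noteq> 0) \<longrightarrow> (\<forall>f\<in>J. torus_act t f \<in> J))"

definition weight_ideal :: "complex ^ 'n::finite \<Rightarrow> (int ^ 'n) set \<Rightarrow> 'n laurent set" where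
  "weight_ideal c S =
     Idl\<^bsub>semigroup_algebra S\<^esub> {laurent_monomial m | m. m \<in> S \<and> pairing m c \<noteq> 0}"

definition coord_set :: "(int ^ 'n::finite) set \<Rightarrow> 'n laurent set \<Rightarrow> 'n super_laurent set" where
  "coord_set S J = carrier (semigroup_algebra S) \<times> J"

definition coord_superalgebra ::
    "(int ^ 'n::finite) set \<Rightarrow> 'n laurent set \<Rightarrow> 'n super_laurent superalgebra" where
  "coord_superalgebra S J = restrict_superalgebra torus_superalgebra (coord_set S J)"

section \<open>The odd derivation\<close>

definition xi :: "'n::finite super_laurent" where
  "xi = (0, 1)"

definition deriv_xi :: "'n::finite super_laurent \<Rightarrow> 'n super_laurent" where
  "deriv_xi F = (snd F, 0)"

definition deriv_x :: "'n::finite \<Rightarrow> 'n super_laurent \<Rightarrow> 'n super_laurent" where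
  "deriv_x i F = (laurent_deriv i (fst F), laurent_deriv i (snd F))"

definition odd_derivation ::
    "complex ^ 'n::finite \<Rightarrow> 'n super_laurent \<Rightarrow> 'n super_laurent" where
  "odd_derivation c F =
     super_mult xi
       (\<Sum>i\<in>UNIV. super_scale (c $ i) (super_mult (laurent_var i, 0) (deriv_x i F))) +
     deriv_xi F"

lemma laurent_deriv_monomial:
  "laurent_deriv i (laurent_monomial m) = Poly_Mapping.single (m - axis i 1) (of_int (m $ i))"
  by (simp add: laurent_deriv_def)

lemma laurent_scale_single:
  "laurent_scale a (Poly_Mapping.single m b) = Poly_Mapping.single m (a * b)"
  by (rule poly_mapping_eqI) (simp add: laurent_scale_def map.rep_eq lookup_single when_def)

lemma laurent_scale_zero: "laurent_scale a 0 = 0"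
  by (rule poly_mapping_eqI) (simp add: laurent_scale_def map.rep_eq)

lemma fst_sum_pair: "fst (sum f A) = (\<Sum>x\<in>A. fst (f x))"
  by (induction A rule: infinite_finite_induct) auto

lemma odd_derivation_monomial:
  "odd_derivation c (laurent_monomial m, 0) = (0, Poly_Mapping.single m (pairing m c))"
proof -
  have single_sum: "(\<Sum>i\<in>A. Poly_Mapping.single m (g i)) = Poly_Mapping.single m (sum g A)"
    for A and g :: "_ \<Rightarrow> complex"
    by (induction A rule: infinite_finite_induct) (auto simp: single_add)
  show ?thesis
    by (simp add: odd_derivation_def super_mult_def super_scale_def deriv_x_def deriv_xi_def
        xi_def fst_sum_pair laurent_deriv_monomial mult_single laurent_scale_single single_sum
        pairing_def mult.commute)
qed

lemma odd_derivation_monomial_xi: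
  "odd_derivation c (0, laurent_monomial m) = (laurent_monomial m, 0)"
  by (simp add: odd_derivation_def super_mult_def super_scale_def deriv_x_def deriv_xi_def
      xi_def fst_sum_pair laurent_deriv_def laurent_scale_zero)

lemma cring_torus_superalgebra: "cring (torus_superalgebra :: 'n::finite super_laurent superalgebra)"
proof (rule cringI)
  show "abelian_group (torus_superalgebra :: 'n super_laurent superalgebra)"
  proof (rule abelian_groupI)
    fix x :: "'n super_laurent"
    show "\<exists>y\<in>carrier torus_superalgebra. y \<oplus>\<^bsub>torus_superalgebra\<^esub> x = \<zero>\<^bsub>torus_superalgebra\<^esub>"
      by (rule bexI[of _ "(- fst x, - snd x)"])
        (auto simp: torus_superalgebra_def prod_eq_iff)
  qed (auto simp: torus_superalgebra_def algebra_simps zero_prod_def)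
  show "Group.comm_monoid (torus_superalgebra :: 'n super_laurent superalgebra)"
    by (rule comm_monoidI) (auto simp: torus_superalgebra_def super_mult_def algebra_simps)
qed (auto simp: torus_superalgebra_def super_mult_def algebra_simps)

end

theory Submission
  imports Defs
begin

text \<open>Let \<open>D\<close> be the derivation scaling \<open>x\<^sup>m\<close> by \<open>\<langle>m, c\<rangle>\<close>. Then \<open>Q (f + \<xi> g) = g + \<xi> D f\<close>, so on the
  invariants of \<open>Q\<^sup>2\<close> the kernel of \<open>Q\<close> is \<open>ker D\<close> in \<open>A\<^sub>0\<close> and its image is \<open>ker D\<close> in \<open>J\<close>.
  The map \<open>f \<mapsto> f mod J\<close> on the former has the latter as its kernel, and it is onto because \<open>J\<close>
  contains every monomial of nonzero weight.\<close>

section \<open>Quotients of superalgebras and the first isomorphism theorem\<close>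

text \<open>The ring axioms mention only these five fields. This is what transfers them from
  \<open>R Quot I\<close> to \<open>quotient_superalgebra R I\<close>, which copies the fields into
  a record of another type.\<close>

lemma ring_cong:
  assumes "ring R" "carrier S = carrier R" "mult S = mult R" "one S = one R"
    "zero S = zero R" "add S = add R"
  shows "ring S"
proof -
  interpret R: ring R by fact
  show ?thesis
  proof (rule ringI)
    show "abelian_group S"
      by (rule abelian_groupI) (use R.l_neg in \<open>auto simp: assms R.a_ac\<close>)
    show "Group.monoid S"
      by (rule monoidI) (simp_all add: assms R.m_assoc)
  qed (simp_all add: assms R.l_distr R.r_distr)
qed

text \<open>Scaling in the quotient is a union over all representatives of a coset. Since
  \<open>a\<close> acts additively and preserves \<open>I\<close>, the cosets in this union
  coincide, and any one representative computes the result.\<close>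

lemma quotient_superalgebra_smult:
  assumes "ideal I R" "x \<in> carrier R"
    and closed: "\<And>x. x \<in> carrier R \<Longrightarrow> a \<odot>\<^bsub>R\<^esub> x \<in> carrier R"
    and add: "\<And>x y. \<lbrakk>x \<in> carrier R; y \<in> carrier R\<rbrakk> \<Longrightarrow> a \<odot>\<^bsub>R\<^esub> (x \<oplus>\<^bsub>R\<^esub> y) = a \<odot>\<^bsub>R\<^esub> x \<oplus>\<^bsub>R\<^esub> a \<odot>\<^bsub>R\<^esub> y"
    and I: "\<And>x. x \<in> I \<Longrightarrow> a \<odot>\<^bsub>R\<^esub> x \<in> I"
  shows "a \<odot>\<^bsub>quotient_superalgebra R I\<^esub> (I +>\<^bsub>R\<^esub> x) = I +>\<^bsub>R\<^esub> (a \<odot>\<^bsub>R\<^esub> x)"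
proof -
  interpret ideal I R by fact
  have const: "I +>\<^bsub>R\<^esub> (a \<odot>\<^bsub>R\<^esub> y) = I +>\<^bsub>R\<^esub> (a \<odot>\<^bsub>R\<^esub> x)" if y: "y \<in> I +>\<^bsub>R\<^esub> x" for y
  proof -
    obtain i where i: "i \<in> I" "y = i \<oplus>\<^bsub>R\<^esub> x"
      using y by (auto simp: a_r_coset_def')
    then have "a \<odot>\<^bsub>R\<^esub> y = a \<odot>\<^bsub>R\<^esub> i \<oplus>\<^bsub>R\<^esub> a \<odot>\<^bsub>R\<^esub> x"
      using add[OF a_Hcarr[OF i(1)] assms(2)] by simp
    then have "a \<odot>\<^bsub>R\<^esub> y \<in> I +>\<^bsub>R\<^esub> (a \<odot>\<^bsub>R\<^esub> x)"
      using I i by (auto simp: a_r_coset_def')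
    then show ?thesis
      using a_repr_independence[OF _ closed[OF assms(2)] a_subgroup] by simp
  qed
  have "(\<Union>y\<in>I +>\<^bsub>R\<^esub> x. I +>\<^bsub>R\<^esub> (a \<odot>\<^bsub>R\<^esub> y)) = I +>\<^bsub>R\<^esub> (a \<odot>\<^bsub>R\<^esub> x)"
    by (rule UN_constant_eq[OF a_rcos_self[OF assms(2)]]) (intro ballI const)
  then show ?thesis
    by (simp add: quotient_superalgebra_def)
qed

text \<open>The isomorphism is the one that \<open>h\<close> induces on the underlying rings. It
  sends the coset of \<open>x\<close> to \<open>h x\<close>, so scalars and parity can be checked on
  representatives.\<close>

theorem quotient_kernel_isomorphic:
  fixes R :: "'a superalgebra" and S :: "'b superalgebra"
  assumes "ring_hom_ring R S h" and surj: "h ` carrier R = carrier S"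
    and closed: "\<And>a x. x \<in> carrier R \<Longrightarrow> a \<odot>\<^bsub>R\<^esub> x \<in> carrier R"
    and add: "\<And>a x y. \<lbrakk>x \<in> carrier R; y \<in> carrier R\<rbrakk>
      \<Longrightarrow> a \<odot>\<^bsub>R\<^esub> (x \<oplus>\<^bsub>R\<^esub> y) = a \<odot>\<^bsub>R\<^esub> x \<oplus>\<^bsub>R\<^esub> a \<odot>\<^bsub>R\<^esub> y"
    and smult: "\<And>a x. x \<in> carrier R \<Longrightarrow> h (a \<odot>\<^bsub>R\<^esub> x) = a \<odot>\<^bsub>S\<^esub> h x"
    and parts: "even_part R \<subseteq> carrier R" "odd_part R \<subseteq> carrier R"
      "h ` even_part R = even_part S" "h ` odd_part R = odd_part S"
  shows "quotient_superalgebra R (a_kernel R S h) \<cong>\<^sub>s S"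
proof -
  interpret ring_hom_ring R S h by fact
  let ?K = "a_kernel R S h" and ?\<phi> = "\<lambda>X. the_elem (h ` X)"
  have iso: "?\<phi> \<in> ring_iso (R Quot ?K) S"
    using FactRing_iso_set surj by blast
  have \<phi>: "?\<phi> (?K +>\<^bsub>R\<^esub> x) = h x" if "x \<in> carrier R" for x
    using the_elem_simp that by blast
  \<comment> \<open>Additivity gives \<open>a 0 = a 0 + a 0\<close>, and one summand
    cancels.\<close>
  have zero: "a \<odot>\<^bsub>R\<^esub> \<zero>\<^bsub>R\<^esub> = \<zero>\<^bsub>R\<^esub>" for a
    using add[of "\<zero>\<^bsub>R\<^esub>" "\<zero>\<^bsub>R\<^esub>" a] closed[of "\<zero>\<^bsub>R\<^esub>" a]
    by (metis R.add.l_cancel_one R.l_zero R.zero_closed)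
  have K_smult: "a \<odot>\<^bsub>R\<^esub> x \<in> ?K" if "x \<in> ?K" for a x
  proof -
    have mem_K: "y \<in> ?K \<longleftrightarrow> y \<in> carrier R \<and> h y = \<zero>\<^bsub>S\<^esub>" for y
      by (simp only: a_kernel_def' mem_Collect_eq)
    then have x: "x \<in> carrier R" "h x = \<zero>\<^bsub>S\<^esub>"
      using that by blast+
    \<comment> \<open>Nothing is assumed about scalars in \<open>S\<close> beyond compatibility with
      \<open>h\<close>, so the multiple of zero in \<open>S\<close> is computed as the image of a
      multiple of zero in \<open>R\<close>.\<close>
    then have "h (a \<odot>\<^bsub>R\<^esub> x) = h (a \<odot>\<^bsub>R\<^esub> \<zero>\<^bsub>R\<^esub>)"
      using smult[OF x(1)] smult[OF R.zero_closed] hom_zero by metis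
    then show ?thesis
      using closed[OF x(1)] zero mem_K by simp
  qed
  have "?\<phi> (a \<odot>\<^bsub>quotient_superalgebra R ?K\<^esub> X) = a \<odot>\<^bsub>S\<^esub> ?\<phi> X"
    if X: "X \<in> carrier (R Quot ?K)" for a X
  proof -
    obtain x where x: "x \<in> carrier R" "X = ?K +>\<^bsub>R\<^esub> x"
      using X by (auto simp: FactRing_def A_RCOSETS_def')
    then show ?thesis
      using quotient_superalgebra_smult[OF kernel_is_ideal x(1) closed add K_smult]
      by (simp add: \<phi> closed smult)
  qed
  moreover have "?\<phi> ` (\<lambda>x. ?K +>\<^bsub>R\<^esub> x) ` P = h ` P" if "P \<subseteq> carrier R" for P
    unfolding image_image by (rule image_cong[OF refl \<phi>]) (use that in blast)
  ultimately have "?\<phi> \<in> superalgebra_iso (quotient_superalgebra R ?K) S"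
    using iso parts
    by (simp add: superalgebra_iso_def quotient_superalgebra_def ring_iso_def ring_hom_def)
  then show ?thesis
    by (auto simp: superalgebra_isomorphic_def)
qed

section \<open>The odd derivation in terms of exponents\<close>

text \<open>This is \<open>D\<close>, the Euler operator with coefficients \<open>c\<close>, given
  in diagonal form so that its kernel can be read off from the exponents.\<close>

definition weight_deriv :: "complex ^ 'n::finite \<Rightarrow> 'n laurent \<Rightarrow> 'n laurent" where
  "weight_deriv c f = Poly_Mapping.mapp (\<lambda>m a. pairing m c * a) f"

lemma lookup_laurent_scale [simp]:
  "Poly_Mapping.lookup (laurent_scale a f) m = a * Poly_Mapping.lookup f m"
  by (simp add: laurent_scale_def map.rep_eq when_def)

lemma lookup_weight_deriv [simp]:
  "Poly_Mapping.lookup (weight_deriv c f) m = pairing m c * Poly_Mapping.lookup f m"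
  by (simp add: weight_deriv_def mapp.rep_eq when_def in_keys_iff)

text \<open>Multiplication by the variable undoes the shift of exponents in the derivative, so their
  composite is diagonal in the monomials.\<close>

lemma lookup_var_mult_deriv:
  "Poly_Mapping.lookup (laurent_var i * laurent_deriv i f) m
     = of_int (m $ i) * Poly_Mapping.lookup f m"
  by (simp add: laurent_deriv_def sum_distrib_left mult_single lookup_sum lookup_single
      when_def in_keys_iff)

text \<open>Multiplication by \<open>xi\<close> moves the first component to the second and kills
  the rest because \<open>xi\<close> squares to zero. The derivative in \<open>xi\<close> supplies
  the first component.\<close>

lemma odd_derivation_eq: "odd_derivation c F = (snd F, weight_deriv c (fst F))"
proof -
  have "(\<Sum>i\<in>UNIV. laurent_scale (c $ i) (laurent_var i * laurent_deriv i (fst F)))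
      = weight_deriv c (fst F)"
    by (rule poly_mapping_eqI)
      (simp add: lookup_sum lookup_var_mult_deriv pairing_def sum_distrib_right, simp add: mult_ac)
  then show ?thesis
    by (simp add: odd_derivation_def super_mult_def super_scale_def deriv_x_def deriv_xi_def
        xi_def fst_sum_pair)
qed

lemma weight_deriv_eq_0_iff:
  "weight_deriv c f = 0 \<longleftrightarrow> Poly_Mapping.keys f \<subseteq> {m. pairing m c = 0}"
  by (auto simp: poly_mapping_eq_iff fun_eq_iff in_keys_iff)

lemma keys_laurent_scale: "Poly_Mapping.keys (laurent_scale a f) \<subseteq> Poly_Mapping.keys f"
  by (auto simp: in_keys_iff)

lemma laurent_scale_add: "laurent_scale a (f + g) = laurent_scale a f + laurent_scale a g"
  by (rule poly_mapping_eqI) (simp add: lookup_add algebra_simps)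

lemma sum_monomials:
  "(\<Sum>m\<in>Poly_Mapping.keys f. Poly_Mapping.single m (Poly_Mapping.lookup f m)) = f"
  by (rule poly_mapping_eqI) (simp add: lookup_sum lookup_single when_def in_keys_iff)

text \<open>Scalars become constants of the ring, so closure of an ideal under multiplication gives
  closure under scaling.\<close>

lemma laurent_scale_eq_mult: "laurent_scale a f = Poly_Mapping.single 0 a * f"
proof -
  have "Poly_Mapping.single 0 a * f
      = Poly_Mapping.single 0 a * (\<Sum>m\<in>Poly_Mapping.keys f. Poly_Mapping.single m (Poly_Mapping.lookup f m))"
    by (simp add: sum_monomials)
  also have "\<dots> = laurent_scale a f"
    by (rule poly_mapping_eqI)
      (simp add: sum_distrib_left mult_single lookup_sum lookup_single when_def in_keys_iff)
  finally show ?thesis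
    by simp
qed

section \<open>Semigroup algebras, their ideals and the splitting by weight\<close>

lemma semigroup_algebra_simps:
  "carrier (semigroup_algebra S) = {f. Poly_Mapping.keys f \<subseteq> S}"
  "mult (semigroup_algebra S) = (*)" "one (semigroup_algebra S) = 1"
  "zero (semigroup_algebra S) = 0" "add (semigroup_algebra S) = (+)"
  "smult (semigroup_algebra S) = laurent_scale"
  "even_part (semigroup_algebra S) = {f. Poly_Mapping.keys f \<subseteq> S}"
  "odd_part (semigroup_algebra S) = {0}"
  by (simp_all add: semigroup_algebra_def)

lemma keys_mult_subset:
  assumes "\<And>m n. \<lbrakk>m \<in> T; n \<in> T\<rbrakk> \<Longrightarrow> m + n \<in> T"
    and "Poly_Mapping.keys f \<subseteq> T" "Poly_Mapping.keys g \<subseteq> T"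
  shows "Poly_Mapping.keys (f * g) \<subseteq> T"
  using keys_mult[of f g] assms by fastforce

text \<open>Closure of the carrier is tested on monomials: 1 is x^0, and x^m x^n is x^(m+n).\<close>

lemma submonoid_of_ring_semigroup_algebra:
  assumes "ring (semigroup_algebra S)"
  shows "0 \<in> S" and "\<lbrakk>m \<in> S; n \<in> S\<rbrakk> \<Longrightarrow> m + n \<in> S"
proof -
  interpret ring "semigroup_algebra S" by fact
  show "0 \<in> S"
    using one_closed by (simp add: semigroup_algebra_simps)
  show "m + n \<in> S" if "m \<in> S" "n \<in> S"
    using m_closed[of "laurent_monomial m" "laurent_monomial n"] that
    by (simp add: semigroup_algebra_simps mult_single)
qed

lemma pairing_add: "pairing (m + n) c = pairing m c + pairing n c"
  by (simp add: pairing_def algebra_simps sum.distrib)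

lemma pairing_0: "pairing 0 c = 0"
  by (simp add: pairing_def)

lemma ideal_semigroup_algebra_scale:
  assumes "ideal J (semigroup_algebra S)" "f \<in> J"
  shows "laurent_scale a f \<in> J"
proof -
  interpret ideal J "semigroup_algebra S" by fact
  have "Poly_Mapping.single 0 a \<in> carrier (semigroup_algebra S)"
    using submonoid_of_ring_semigroup_algebra(1)[OF ring_axioms] by (simp add: semigroup_algebra_simps)
  then show ?thesis
    using I_l_closed[OF assms(2)] by (simp add: laurent_scale_eq_mult semigroup_algebra_simps)
qed

text \<open>Every \<open>f\<close> is a finite linear combination of its monomials, and an ideal is
  a linear subspace.\<close>

lemma ideal_memI_keys:
  assumes "ideal J (semigroup_algebra S)"
    and "\<And>m. m \<in> Poly_Mapping.keys f \<Longrightarrow> laurent_monomial m \<in> J"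
  shows "f \<in> J"
proof -
  interpret ideal J "semigroup_algebra S" by fact
  have "(\<Sum>m\<in>A. Poly_Mapping.single m (Poly_Mapping.lookup f m)) \<in> J"
    if "finite A" "A \<subseteq> Poly_Mapping.keys f" for A
    using that
  proof induction
    case empty
    then show ?case
      using additive_subgroup.zero_closed[OF additive_subgroup_axioms] by (simp add: semigroup_algebra_simps)
  next
    case (insert m A)
    then have "laurent_scale (Poly_Mapping.lookup f m) (laurent_monomial m) \<in> J"
      using ideal_semigroup_algebra_scale assms by blast
    with insert show ?case
      using additive_subgroup.a_closed[OF additive_subgroup_axioms] by (simp add: laurent_scale_single semigroup_algebra_simps)
  qed
  from this[OF finite_keys order_refl] show ?thesis
    by (simp add: sum_monomials)
qed

lemma weight_ideal_memI:
  assumes "ring (semigroup_algebra S)"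
    and "Poly_Mapping.keys f \<subseteq> {m \<in> S. pairing m c \<noteq> 0}"
  shows "f \<in> weight_ideal c S"
proof -
  interpret ring "semigroup_algebra S" by fact
  let ?G = "{laurent_monomial m | m. m \<in> S \<and> pairing m c \<noteq> 0}"
  have G: "?G \<subseteq> carrier (semigroup_algebra S)"
    by (auto simp: semigroup_algebra_simps)
  show ?thesis
    unfolding weight_ideal_def
    by (rule ideal_memI_keys[OF genideal_ideal[OF G]]) (use assms genideal_self[OF G] in blast)
qed

text \<open>Each term goes to \<open>g\<close> or to \<open>h\<close> according to whether its
  weight vanishes. Thus a class modulo an ideal containing \<open>weight_ideal c S\<close> has a
  representative killed by \<open>D\<close>.\<close>

lemma weight_decomposition:
  assumes "ring (semigroup_algebra S)" "Poly_Mapping.keys f \<subseteq> S"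
  obtains g h where "f = h + g" "Poly_Mapping.keys g \<subseteq> {m \<in> S. pairing m c = 0}"
    "h \<in> weight_ideal c S"
proof
  let ?g = "Poly_Mapping.mapp (\<lambda>m a. a when pairing m c = 0) f"
  let ?h = "Poly_Mapping.mapp (\<lambda>m a. a when pairing m c \<noteq> 0) f"
  show "f = ?h + ?g"
    by (rule poly_mapping_eqI) (simp add: lookup_add mapp.rep_eq when_def in_keys_iff)
  show "Poly_Mapping.keys ?g \<subseteq> {m \<in> S. pairing m c = 0}"
    using assms(2) by (auto simp: in_keys_iff mapp.rep_eq when_def split: if_splits)
  show "?h \<in> weight_ideal c S"
    by (rule weight_ideal_memI)
      (use assms in \<open>auto simp: in_keys_iff mapp.rep_eq when_def split: if_splits\<close>)
qed

section \<open>Comparison of the Duflo-Serganova quotient with A_0/J\<close>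

theorem proposition5p16:
  fixes c :: "complex ^ 'n::finite"
    and S :: "(int ^ 'n) set"
    and J :: "'n laurent set"
  assumes "affine_semigroup S"
    and "lattice_span S = UNIV"
    and "ideal J (semigroup_algebra S)"
    and "J \<noteq> {0}"
    and "torus_invariant J"
    and "weight_ideal c S \<subseteq> J"
    and "affine_toric_supervariety c (coord_set S J)"
  shows "DS (odd_derivation c) (coord_superalgebra S J)
           \<cong>\<^sub>s quotient_superalgebra (semigroup_algebra S) J"
proof -
  interpret J: ideal J "semigroup_algebra S" by fact
  note S = submonoid_of_ring_semigroup_algebra[OF J.ring_axioms]
  let ?Q = "odd_derivation c"
  define W where "W = {m \<in> S. pairing m c = 0}"
  let ?I = "square_invariants (coord_superalgebra S J) ?Q"
  define R where "R = restrict_superalgebra (coord_superalgebra S J) {f \<in> ?I. ?Q f = \<zero>\<^bsub>coord_superalgebra S J\<^esub>}"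
  define A where "A = quotient_superalgebra (semigroup_algebra S) J"
  let ?h = "\<lambda>F. J +>\<^bsub>semigroup_algebra S\<^esub> fst F"
  have zero_J: "0 \<in> J"
    using additive_subgroup.zero_closed[OF J.additive_subgroup_axioms] by (simp add: semigroup_algebra_simps)
  have J_sub: "Poly_Mapping.keys f \<subseteq> S" if "f \<in> J" for f
    using J.Icarr[OF that] by (simp add: semigroup_algebra_simps)
  \<comment> \<open>Here \<open>Q (Q (f, g)) = (D f, D g)\<close>, so invariance means that both
    components have weight zero. The inclusion of \<open>J\<close> in A_0 keeps the exponents of
    \<open>g\<close> in \<open>S\<close>.\<close>
  have I: "?I = {F. Poly_Mapping.keys (fst F) \<subseteq> W \<and> snd F \<in> J \<and> Poly_Mapping.keys (snd F) \<subseteq> W}"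
    using J_sub
    by (fastforce simp: square_invariants_def coord_superalgebra_def restrict_superalgebra_def
        torus_superalgebra_def coord_set_def odd_derivation_eq weight_deriv_eq_0_iff
        semigroup_algebra_simps W_def)
  \<comment> \<open>On invariants \<open>D f = 0\<close> already, so
    \<open>Q (f, g) = (g, 0)\<close> and the only new condition is \<open>g = 0\<close>. The kernel
    is therefore purely even.\<close>
  have ker: "{f \<in> ?I. ?Q f = \<zero>\<^bsub>coord_superalgebra S J\<^esub>} = {f. Poly_Mapping.keys f \<subseteq> W} \<times> {0}"
  proof -
    have "\<zero>\<^bsub>coord_superalgebra S J\<^esub> = (0, 0)"
      by (simp add: coord_superalgebra_def restrict_superalgebra_def torus_superalgebra_def)
    then show ?thesis
      using zero_J by (auto simp: I odd_derivation_eq weight_deriv_eq_0_iff W_def)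
  qed
  have R: "carrier R = {f. Poly_Mapping.keys f \<subseteq> W} \<times> {0}" "mult R = super_mult"
    "one R = (1, 0)" "zero R = (0, 0)" "add R = (+)" "smult R = super_scale"
    "even_part R = {f. Poly_Mapping.keys f \<subseteq> W} \<times> {0}" "odd_part R = {(0, 0)}"
    unfolding R_def ker using zero_J
    by (auto simp: W_def restrict_superalgebra_def coord_superalgebra_def torus_superalgebra_def
        coord_set_def semigroup_algebra_simps)
  have W_add: "Poly_Mapping.keys (f + g) \<subseteq> W"
    if "Poly_Mapping.keys f \<subseteq> W" "Poly_Mapping.keys g \<subseteq> W" for f g :: "'n laurent"
    using that keys_add[of f g] by blast
  have W_mult: "Poly_Mapping.keys (f * g) \<subseteq> W"
    if "Poly_Mapping.keys f \<subseteq> W" "Poly_Mapping.keys g \<subseteq> W" for f g :: "'n laurent"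
    by (rule keys_mult_subset) (use that S in \<open>auto simp: pairing_add W_def\<close>)
  have W_S: "Poly_Mapping.keys f \<subseteq> S" if "Poly_Mapping.keys f \<subseteq> W" for f :: "'n laurent"
    using that by (auto simp: W_def)
  have "0 \<in> W"
    using S by (simp add: W_def pairing_0)
  have "ring R"
  proof (rule ringI)
    show "abelian_group R"
    proof (rule abelian_groupI)
      fix x assume "x \<in> carrier R"
      then show "\<exists>y\<in>carrier R. y \<oplus>\<^bsub>R\<^esub> x = \<zero>\<^bsub>R\<^esub>"
        by (intro bexI[of _ "- x"]) (auto simp: R zero_prod_def)
    qed (auto simp: R algebra_simps zero_prod_def W_add)
    show "Group.monoid R"
      by (rule monoidI)
        (auto simp: R super_mult_def mult.assoc \<open>0 \<in> W\<close> dest: subsetD[OF W_mult, rotated 2])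
  qed (auto simp: R super_mult_def algebra_simps)
  moreover have "ring A"
    by (rule ring_cong[OF J.quotient_is_ring]) (simp_all add: A_def quotient_superalgebra_def)
  \<comment> \<open>Second components vanish on \<open>R\<close>, so \<open>super_mult\<close> is
    the product of Laurent polynomials there and \<open>?h\<close> is a restriction of the quotient
    map modulo \<open>J\<close>.\<close>
  moreover have "?h \<in> ring_hom R A"
    using J.rcos_ring_hom W_S
    by (auto simp: ring_hom_def R semigroup_algebra_simps A_def quotient_superalgebra_def
        super_mult_def Pi_def)
  ultimately have hom: "ring_hom_ring R A ?h"
    by (rule ring_hom_ringI2)
  have onto: "?h ` ({f. Poly_Mapping.keys f \<subseteq> W} \<times> {0})
      = (\<lambda>f. J +>\<^bsub>semigroup_algebra S\<^esub> f) ` {f. Poly_Mapping.keys f \<subseteq> S}"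
  proof (intro equalityI subsetI)
    fix X assume "X \<in> (\<lambda>f. J +>\<^bsub>semigroup_algebra S\<^esub> f) ` {f. Poly_Mapping.keys f \<subseteq> S}"
    then obtain f where f: "Poly_Mapping.keys f \<subseteq> S" "X = J +>\<^bsub>semigroup_algebra S\<^esub> f"
      by blast
    \<comment> \<open>The part \<open>h\<close> of nonzero weight lies in
      \<open>weight_ideal c S\<close>, hence in \<open>J\<close>, so the part \<open>g\<close> of
      weight zero represents the same coset as \<open>f\<close>.\<close>
    obtain g h where gh: "f = h + g" "Poly_Mapping.keys g \<subseteq> W" "h \<in> weight_ideal c S"
      using weight_decomposition[OF J.ring_axioms f(1)] unfolding W_def .
    then have "f \<in> J +>\<^bsub>semigroup_algebra S\<^esub> g"
      using assms(6) by (auto simp: a_r_coset_def' semigroup_algebra_simps)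
    moreover have "g \<in> carrier (semigroup_algebra S)"
      using gh(2) W_S by (simp add: semigroup_algebra_simps)
    ultimately have "X = ?h (g, 0)"
      using J.a_repr_independence[OF _ _ J.a_subgroup] f(2) by simp
    then show "X \<in> ?h ` ({f. Poly_Mapping.keys f \<subseteq> W} \<times> {0})"
      using gh(2) by blast
  qed (use W_S in auto)
  have carrier_A: "carrier A = (\<lambda>f. J +>\<^bsub>semigroup_algebra S\<^esub> f) ` {f. Poly_Mapping.keys f \<subseteq> S}"
    by (auto simp: A_def quotient_superalgebra_def FactRing_def A_RCOSETS_def' semigroup_algebra_simps)
  have smult_A: "a \<odot>\<^bsub>A\<^esub> (J +>\<^bsub>semigroup_algebra S\<^esub> f) = J +>\<^bsub>semigroup_algebra S\<^esub> laurent_scale a f"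
    if "Poly_Mapping.keys f \<subseteq> S" for a f
  proof -
    have "a \<odot>\<^bsub>A\<^esub> (J +>\<^bsub>semigroup_algebra S\<^esub> f)
        = J +>\<^bsub>semigroup_algebra S\<^esub> (a \<odot>\<^bsub>semigroup_algebra S\<^esub> f)"
      unfolding A_def
      by (rule quotient_superalgebra_smult[OF assms(3)])
        (use that ideal_semigroup_algebra_scale[OF assms(3)] in
          \<open>auto simp: semigroup_algebra_simps laurent_scale_add
             dest: subsetD[OF keys_laurent_scale]\<close>)
    then show ?thesis
      by (simp add: semigroup_algebra_simps)
  qed
  have "a_kernel R A ?h = {F \<in> carrier R. fst F \<in> J}"
  proof -
    have "J +>\<^bsub>semigroup_algebra S\<^esub> f = J \<longleftrightarrow> f \<in> J" if "Poly_Mapping.keys f \<subseteq> S" for f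
      using that J.rcos_const_imp_mem[of f] J.a_rcos_const[of f]
      by (auto simp: semigroup_algebra_simps)
    then show ?thesis
      using W_S by (force simp: a_kernel_def' R A_def quotient_superalgebra_def FactRing_def)
  qed
  \<comment> \<open>A weight-zero \<open>f\<close> in \<open>J\<close> is the image of
    \<open>(0, f)\<close>, which belongs to C[X] because \<open>f\<close> is in \<open>J\<close>.
    Conversely, \<open>Q\<close> sends an invariant \<open>(f, g)\<close> to \<open>(g, 0)\<close>
    with \<open>g\<close> in \<open>J\<close>.\<close>
  also have "\<dots> = ?Q ` ?I"
  proof (intro equalityI subsetI)
    fix F assume "F \<in> {F \<in> carrier R. fst F \<in> J}"
    then have "F = ?Q (0, fst F)" "(0, fst F) \<in> ?I"
      by (auto simp: R I odd_derivation_eq weight_deriv_eq_0_iff W_def)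
    then show "F \<in> ?Q ` ?I"
      by blast
  next
    fix F assume "F \<in> ?Q ` ?I"
    then show "F \<in> {F \<in> carrier R. fst F \<in> J}"
      by (auto simp: R I odd_derivation_eq weight_deriv_eq_0_iff W_def)
  qed
  finally have kernel: "a_kernel R A ?h = ?Q ` ?I" .
  have scale_add: "super_scale a (F + G) = super_scale a F + super_scale a G"
    for a and F G :: "'n super_laurent"
    by (simp add: super_scale_def laurent_scale_add)
  have "quotient_superalgebra R (a_kernel R A ?h) \<cong>\<^sub>s A"
  proof (rule quotient_kernel_isomorphic[OF hom])
    show "?h ` carrier R = carrier A"
      using onto by (simp add: R carrier_A)
    show "?h ` even_part R = even_part A"
      using onto by (simp add: R A_def quotient_superalgebra_def semigroup_algebra_simps)
    show "?h ` odd_part R = odd_part A"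
      by (simp add: R A_def quotient_superalgebra_def semigroup_algebra_simps)
    fix a F assume F: "F \<in> carrier R"
    then show "a \<odot>\<^bsub>R\<^esub> F \<in> carrier R"
      using keys_laurent_scale by (fastforce simp: R super_scale_def laurent_scale_zero)
    have "Poly_Mapping.keys (fst F) \<subseteq> S"
      using F by (auto simp: R W_def)
    then show "?h (a \<odot>\<^bsub>R\<^esub> F) = a \<odot>\<^bsub>A\<^esub> ?h F"
      by (simp add: R super_scale_def smult_A)
  qed (auto simp: R scale_add)
  then show ?thesis
    \<comment> \<open>By \<open>kernel\<close>, the ideal divided out in \<open>DS\<close> is the
      kernel of \<open>?h\<close>.\<close>
    by (simp add: kernel DS_def flip: R_def A_def)
qed

end
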